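(* Let $(X,\{R_i\}_{i=0}^3)$ be a symmetric association scheme with $3$ classes that is $Q$-polynomial with respect to an ordering $E_0,E_1,E_2,E_3$ of its primitive idempotents, and that is $Q$-antipodal with equivalence relation $R_0\cup R_2$. Then the following are equivalent. (1) $(X,\{R_i\}_{i=0}^3)$ is triply regular. (2) $a_1^*=0$.
   Context: Let $(X,\{R_i\}_{i=0}^D)$ be a symmetric association scheme ($X$ finite, $R_0$ the diagonal relation) with adjacency matrices $A_i$ and primitive idempotents $E_0=\frac1{|X|}J,E_1,\dots,E_D$. The Krein numbers $q_{i,j}^k$ are defined by $E_i\circ E_j=\frac1{|X|}\sum_{k}q_{i,j}^kE_k$, where $\circ$ is the entrywise product. The scheme is $Q$-polynomial with respect to the ordering $E_0,E_1,\dots,E_D$ if for each $i$ there is a polynomial $v_i^*$ of degree $i$ such that $|X|E_i$ is obtained by applying $v_i^*$ entrywise to $|X|E_1$. In this case put $a_i^*=q_{1,i}^i$, $b_i^*=q_{1,i+1}^i$, $c_i^*=q_{1,i-1}^i$ with respect to this ordering. A $Q$-polynomial scheme is $Q$-antipodal if $b_j^*=c_{D-j}^*$ for all $0\le j\le D$ except possibly $j=\lfloor D/2\rfloor$ (with $b_D^*=c_0^*=0$). It is $Q$-antipodal with equivalence relation $\mathcal R$ (a union of some of the $R_i$) if in addition $\mathcal R$ is the equivalence relation on $X$ whose adjacency matrix $\sum_{R_i\subseteq\mathcal R}A_i$ is a scalar multiple of $E_0+E_D$. For $D=3$ and $\mathcal R=R_0\cup R_2$ this means that $A_0+A_2$ is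 a scalar multiple of $E_0+E_3$. For $x\in X$ write $R_i(x)=\{y\in X\mid (x,y)\in R_i\}$. The scheme is triply regular if for all $i,j,k,l,m,n\in\{0,\dots,D\}$ and all $x,y,z\in X$ with $(x,y)\in R_i$, $(y,z)\in R_j$, $(z,x)\in R_k$, the number $|R_m(x)\cap R_n(y)\cap R_l(z)|$ depends only on $i,j,k,l,m,n$ and not on the choice of $x,y,z$. *)

theory Defs
  imports "HOL-Analysis.Analysis" "HOL-Computational_Algebra.Polynomial"
begin

text \<open>The vertex set \<open>X\<close> is the universe of a finite type \<open>'a\<close>. A scheme with \<open>D\<close> classes is
  a family \<open>R\<close> of relations of which only the members with index at most \<open>D\<close> matter.\<close>

definition symmetric_association_scheme :: "nat \<Rightarrow> (nat \<Rightarrow> ('a::finite) rel) \<Rightarrow> bool" where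
  "symmetric_association_scheme D R \<longleftrightarrow>
     R 0 = Id \<and>
     (\<forall>i\<le>D. R i \<noteq> {}) \<and>
     (\<forall>i\<le>D. \<forall>j\<le>D. i \<noteq> j \<longrightarrow> R i \<inter> R j = {}) \<and>
     (\<Union>i\<le>D. R i) = UNIV \<and>
     (\<forall>i\<le>D. sym (R i)) \<and>
     (\<forall>i\<le>D. \<forall>j\<le>D. \<forall>k\<le>D. \<exists>p::nat. \<forall>x y. (x, y) \<in> R k \<longrightarrow>
        card {z. (x, z) \<in> R i \<and> (z, y) \<in> R j} = p)"

definition adj_matrix :: "('a::finite) rel \<Rightarrow> real^'a^'a" where
  "adj_matrix r = (\<chi> x y. if (x, y) \<in> r then 1 else 0)"

definition bose_mesner :: "nat \<Rightarrow> (nat \<Rightarrow> ('a::finite) rel) \<Rightarrow> (real^'a^'a) set" where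
  "bose_mesner D R = span ((\<lambda>i. adj_matrix (R i)) ` {..D})"

definition primitive_idempotent_in :: "(real^'a^'a) set \<Rightarrow> real^'a^('a::finite) \<Rightarrow> bool" where
  "primitive_idempotent_in \<A> e \<longleftrightarrow>
     e \<in> \<A> \<and> e \<noteq> 0 \<and> e ** e = e \<and>
     \<not> (\<exists>f\<in>\<A>. \<exists>g\<in>\<A>. f \<noteq> 0 \<and> g \<noteq> 0 \<and> f ** f = f \<and> g ** g = g \<and>
          f ** g = 0 \<and> g ** f = 0 \<and> e = f + g)"

definition primitive_idempotent_ordering ::
    "nat \<Rightarrow> (nat \<Rightarrow> ('a::finite) rel) \<Rightarrow> (nat \<Rightarrow> real^'a^'a) \<Rightarrow> bool" where
  "primitive_idempotent_ordering D R E \<longleftrightarrow>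
     bij_betw E {..D} {e. primitive_idempotent_in (bose_mesner D R) e} \<and>
     E 0 = (1 / real CARD('a)) *\<^sub>R (\<chi> x y. 1)"

text \<open>On \<open>real^'a^'a\<close> the operation \<open>*\<close> is the entrywise product (the matrix product is \<open>**\<close>).
  The sequence of coefficients below is made unique by linear independence of the \<open>E k\<close> with
  \<open>k \<le> D\<close> and by requiring the coefficients beyond \<open>D\<close> to vanish.\<close>

definition krein :: "nat \<Rightarrow> (nat \<Rightarrow> real^'a^('a::finite)) \<Rightarrow> nat \<Rightarrow> nat \<Rightarrow> nat \<Rightarrow> real" where
  "krein D E i j = (THE q. (\<forall>k>D. q k = 0) \<and>
     E i * E j = (1 / real CARD('a)) *\<^sub>R (\<Sum>k\<le>D. q k *\<^sub>R E k))"

definition Q_polynomial :: "nat \<Rightarrow> (nat \<Rightarrow> real^'a^('a::finite)) \<Rightarrow> bool" where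
  "Q_polynomial D E \<longleftrightarrow>
     (\<forall>i\<le>D. \<exists>v :: real poly. degree v = i \<and>
        (\<forall>x y. real CARD('a) * E i $ x $ y = poly v (real CARD('a) * E 1 $ x $ y)))"

definition a_star :: "nat \<Rightarrow> (nat \<Rightarrow> real^'a^('a::finite)) \<Rightarrow> nat \<Rightarrow> real" where
  "a_star D E i = krein D E 1 i i"

definition b_star :: "nat \<Rightarrow> (nat \<Rightarrow> real^'a^('a::finite)) \<Rightarrow> nat \<Rightarrow> real" where
  "b_star D E i = (if i < D then krein D E 1 (i + 1) i else 0)"

definition c_star :: "nat \<Rightarrow> (nat \<Rightarrow> real^'a^('a::finite)) \<Rightarrow> nat \<Rightarrow> real" where
  "c_star D E i = (if i > 0 then krein D E 1 (i - 1) i else 0)"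

definition Q_antipodal :: "nat \<Rightarrow> (nat \<Rightarrow> real^'a^('a::finite)) \<Rightarrow> bool" where
  "Q_antipodal D E \<longleftrightarrow>
     Q_polynomial D E \<and> (\<forall>j\<le>D. j \<noteq> D div 2 \<longrightarrow> b_star D E j = c_star D E (D - j))"

definition Q_antipodal_with ::
    "nat \<Rightarrow> (nat \<Rightarrow> ('a::finite) rel) \<Rightarrow> (nat \<Rightarrow> real^'a^'a) \<Rightarrow> 'a rel \<Rightarrow> bool" where
  "Q_antipodal_with D R E r \<longleftrightarrow>
     Q_antipodal D E \<and> equiv UNIV r \<and> (\<exists>I\<subseteq>{..D}. r = (\<Union>i\<in>I. R i)) \<and>
     (\<exists>c::real. (\<Sum>i | i \<le> D \<and> R i \<subseteq> r. adj_matrix (R i)) = c *\<^sub>R (E 0 + E D))"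

text \<open>\<open>R i `` {x}\<close> is the set of all \<open>y\<close> with \<open>(x, y) \<in> R i\<close>.\<close>

definition triply_regular :: "nat \<Rightarrow> (nat \<Rightarrow> ('a::finite) rel) \<Rightarrow> bool" where
  "triply_regular D R \<longleftrightarrow>
     (\<forall>i\<le>D. \<forall>j\<le>D. \<forall>k\<le>D. \<forall>l\<le>D. \<forall>m\<le>D. \<forall>n\<le>D. \<exists>p::nat. \<forall>x y z.
        (x, y) \<in> R i \<longrightarrow> (y, z) \<in> R j \<longrightarrow> (z, x) \<in> R k \<longrightarrow>
        card (R m `` {x} \<inter> R n `` {y} \<inter> R l `` {z}) = p)"

end

theory Submission
  imports Defs
begin

text \<open>Put \<open>n = |X|\<close>. The antipodality conditions amount to \<open>E\<^sub>2 = n E\<^sub>1 \<circ> E\<^sub>3\<close>, and therefore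
  \<open>\<theta> = n E\<^sub>1\<close> is the Gram matrix of a system of vectors in which every class (fibre) of \<open>R\<^sub>0 \<union> R\<^sub>2\<close> is a regular
  simplex spanning the whole space. Let \<open>T(x,y,z) = \<Sum>\<^sub>u \<theta>(x,u) \<theta>(y,u) \<theta>(z,u)\<close>. Since
  \<open>\<Sum>\<^sub>x T(x,x,x)\<close> is a positive multiple of \<open>a\<^sub>1\<^sup>*\<close> and \<open>\<Sum> T(x,y,z)\<^sup>2\<close> is \<open>n\<^sup>3 \<Sum>\<^sub>x T(x,x,x)\<close>, the number
  \<open>a\<^sub>1\<^sup>*\<close> vanishes iff \<open>T = 0\<close>.

  Triple regularity means that \<open>\<Sum>\<^sub>u A(x,u) B(y,u) C(z,u)\<close> depends only on the relations between \<open>x\<close>, \<open>y\<close>,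
  \<open>z\<close> for all \<open>A\<close>, \<open>B\<close>, \<open>C\<close> in the Bose-Mesner algebra. This algebra is spanned by \<open>J\<close>, \<open>I\<close>, \<open>\<theta>\<close> and
  the adjacency matrix of \<open>R\<^sub>0 \<union> R\<^sub>2\<close>, and every such sum except \<open>T\<close> always has this property. So \<open>T = 0\<close>
  suffices. Conversely, if \<open>T\<close> depends only on the relations, then as a cubic form it is the same multiple of the
  simplex cubic form of every fibre; distinct fibres have distinct cubic forms, so the multiple is \<open>0\<close>.\<close>

section \<open>The Bose-Mesner algebra\<close>

lemma adj_matrix_nth: "adj_matrix r $ x $ y = (if (x, y) \<in> r then 1 else 0)"
  by (simp add: adj_matrix_def)

lemma matrix_mult_add_left: "(A + B) ** C = A ** C + B ** (C :: real^'n^'m)"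
  by (simp add: matrix_matrix_mult_def vec_eq_iff algebra_simps sum.distrib)

lemma matrix_mult_diff_left: "(A - B) ** C = A ** C - B ** (C :: real^'n^'m)"
  by (simp add: matrix_matrix_mult_def vec_eq_iff algebra_simps sum_subtractf)

lemma matrix_mult_diff_right: "C ** (A - B) = C ** A - C ** (B :: real^'n^'m)"
  by (simp add: matrix_matrix_mult_def vec_eq_iff algebra_simps sum_subtractf)

lemma hadamard_inner: "(A * B) \<bullet> C = A \<bullet> (B * (C :: real^'n^'m))"
  by (simp add: inner_vec_def mult.assoc)

locale scheme =
  fixes D :: nat and R :: "nat \<Rightarrow> ('a::finite) rel"
  assumes scheme: "symmetric_association_scheme D R"
begin

abbreviation "BM \<equiv> bose_mesner D R"

lemma R_0: "R 0 = Id"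
  using scheme by (simp add: symmetric_association_scheme_def)

lemma R_nonempty: "i \<le> D \<Longrightarrow> R i \<noteq> {}"
  using scheme by (simp add: symmetric_association_scheme_def)

lemma R_sym: "i \<le> D \<Longrightarrow> (x, y) \<in> R i \<Longrightarrow> (y, x) \<in> R i"
  using scheme by (simp add: symmetric_association_scheme_def sym_def)

lemma R_unique:
  assumes "i \<le> D" "j \<le> D" "(x, y) \<in> R i" "(x, y) \<in> R j"
  shows "i = j"
proof (rule ccontr)
  assume "i \<noteq> j"
  with scheme assms(1,2) have "R i \<inter> R j = {}" by (simp add: symmetric_association_scheme_def)
  with assms(3,4) show False by blast
qed

lemma R_cover: obtains i where "i \<le> D" "(x, y) \<in> R i"
proof -
  have "(\<Union>i\<le>D. R i) = UNIV"
    using scheme by (simp add: symmetric_association_scheme_def)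
  then have "(x, y) \<in> (\<Union>i\<le>D. R i)" by simp
  then show thesis using that by blast
qed

lemma adj_matrix_sum_nth:
  assumes "i \<le> D" "(x, y) \<in> R i"
  shows "(\<Sum>j\<le>D. f j *\<^sub>R adj_matrix (R j)) $ x $ y = f i"
proof -
  have "(\<Sum>j\<le>D. f j *\<^sub>R adj_matrix (R j)) $ x $ y = (\<Sum>j\<le>D. if j = i then f j else 0)"
    unfolding sum_component
  proof (rule sum.cong)
    show "(f j *\<^sub>R adj_matrix (R j)) $ x $ y = (if j = i then f j else 0)" if "j \<in> {..D}" for j
      using R_unique[of j i x y] assms that by (cases "j = i") (auto simp: adj_matrix_nth)
  qed simp
  then show ?thesis using assms by simp
qed

text \<open>Every entry lies in exactly one relation, so the span of the adjacency matrices is the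
  set of matrices that are constant on each relation. Closure under the entrywise product and
  symmetry are immediate in this form.\<close>

lemma bose_mesner_iff:
  "M \<in> BM \<longleftrightarrow> (\<exists>m. \<forall>i\<le>D. \<forall>x y. (x, y) \<in> R i \<longrightarrow> M $ x $ y = m i)"
proof
  assume "M \<in> BM"
  then have "M \<in> span ((\<lambda>i. adj_matrix (R i)) ` {..D})" by (simp add: bose_mesner_def)
  then show "\<exists>m. \<forall>i\<le>D. \<forall>x y. (x, y) \<in> R i \<longrightarrow> M $ x $ y = m i"
  proof (induction rule: span_induct_alt)
    case base
    show ?case by (rule exI[of _ "\<lambda>_. 0"]) simp
  next
    case (step c A N)
    from step(1) obtain j where j: "j \<le> D" "A = adj_matrix (R j)" by auto
    from step(2) obtain m where m: "\<And>i x y. i \<le> D \<Longrightarrow> (x, y) \<in> R i \<Longrightarrow> N $ x $ y = m i" by blast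
    have "(c *\<^sub>R A + N) $ x $ y = c * (if i = j then 1 else 0) + m i"
      if "i \<le> D" "(x, y) \<in> R i" for i x y
      using R_unique[OF that(1) j(1) that(2)] m[OF that] that(2) j(2)
      by (cases "i = j") (auto simp: adj_matrix_nth)
    then show ?case by (intro exI[of _ "\<lambda>i. c * (if i = j then 1 else 0) + m i"]) blast
  qed
next
  assume "\<exists>m. \<forall>i\<le>D. \<forall>x y. (x, y) \<in> R i \<longrightarrow> M $ x $ y = m i"
  then obtain m where m: "\<And>i x y. i \<le> D \<Longrightarrow> (x, y) \<in> R i \<Longrightarrow> M $ x $ y = m i" by blast
  have "M $ x $ y = (\<Sum>i\<le>D. m i *\<^sub>R adj_matrix (R i)) $ x $ y" for x y
  proof -
    obtain i where "i \<le> D" "(x, y) \<in> R i" using R_cover .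
    then show ?thesis by (simp only: adj_matrix_sum_nth m)
  qed
  then have "M = (\<Sum>i\<le>D. m i *\<^sub>R adj_matrix (R i))" by (simp add: vec_eq_iff)
  moreover have "\<dots> \<in> BM"
    unfolding bose_mesner_def by (intro span_sum span_scale span_base) auto
  ultimately show "M \<in> BM" by simp
qed

lemma bose_mesner_const: "(\<chi> x y. c) \<in> BM"
  unfolding bose_mesner_iff by (rule exI[of _ "\<lambda>_. c"]) simp

lemma adj_matrix_in_bose_mesner: "i \<le> D \<Longrightarrow> adj_matrix (R i) \<in> BM"
  unfolding bose_mesner_def by (intro span_base) auto

lemma subspace_bose_mesner: "subspace BM"
  unfolding bose_mesner_def by (rule subspace_span)

lemma mat_1_in_bose_mesner: "mat 1 \<in> BM"
proof -
  have "mat 1 = adj_matrix (R 0)"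
    by (auto simp: R_0 vec_eq_iff adj_matrix_nth mat_def)
  then show ?thesis using adj_matrix_in_bose_mesner[of 0] by simp
qed

lemma hadamard_in_bose_mesner:
  assumes "M \<in> BM" "N \<in> BM"
  shows "M * N \<in> BM"
proof -
  obtain m n where
    "\<forall>i\<le>D. \<forall>x y. (x, y) \<in> R i \<longrightarrow> M $ x $ y = m i"
    "\<forall>i\<le>D. \<forall>x y. (x, y) \<in> R i \<longrightarrow> N $ x $ y = n i"
    using assms unfolding bose_mesner_iff by blast
  then show ?thesis
    unfolding bose_mesner_iff by (intro exI[of _ "\<lambda>i. m i * n i"]) simp
qed

lemma bose_mesner_sym:
  assumes "M \<in> BM"
  shows "M $ x $ y = M $ y $ x"
proof -
  obtain m where m: "\<forall>i\<le>D. \<forall>x y. (x, y) \<in> R i \<longrightarrow> M $ x $ y = m i"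
    using assms unfolding bose_mesner_iff by blast
  obtain i where "i \<le> D" "(x, y) \<in> R i" using R_cover .
  then show ?thesis using m R_sym by simp
qed

lemma adj_matrix_mult_in_bose_mesner:
  assumes "i \<le> D" "j \<le> D"
  shows "adj_matrix (R i) ** adj_matrix (R j) \<in> BM"
proof -
  have "\<forall>k\<in>{..D}. \<exists>p::nat. \<forall>x y. (x, y) \<in> R k \<longrightarrow> card {z. (x, z) \<in> R i \<and> (z, y) \<in> R j} = p"
    using scheme assms by (simp add: symmetric_association_scheme_def)
  then obtain p :: "nat \<Rightarrow> nat" where p: "\<forall>k\<in>{..D}. \<forall>x y. (x, y) \<in> R k \<longrightarrow>
      card {z. (x, z) \<in> R i \<and> (z, y) \<in> R j} = p k"
    by (rule bchoice[THEN exE])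
  have "(adj_matrix (R i) ** adj_matrix (R j)) $ x $ y
      = real (card {z. (x, z) \<in> R i \<and> (z, y) \<in> R j})" for x y
  proof -
    have "(adj_matrix (R i) ** adj_matrix (R j)) $ x $ y
        = (\<Sum>z\<in>UNIV. if (x, z) \<in> R i \<and> (z, y) \<in> R j then 1 else 0)"
      unfolding matrix_matrix_mult_def by (auto simp: adj_matrix_nth intro!: sum.cong)
    then show ?thesis by (simp add: sum.If_cases)
  qed
  with p show ?thesis
    unfolding bose_mesner_iff by (intro exI[of _ "\<lambda>k. real (p k)"]) simp
qed

lemma matrix_mult_in_bose_mesner:
  assumes "M \<in> BM" "N \<in> BM"
  shows "M ** N \<in> BM"
proof -
  have adj: "adj_matrix (R i) ** N \<in> BM" if "i \<le> D" for i
    using assms(2)[unfolded bose_mesner_def]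
  proof (induction rule: span_induct_alt)
    case base
    show ?case using subspace_0[OF subspace_bose_mesner] by simp
  next
    case (step c A B)
    then show ?case
      using adj_matrix_mult_in_bose_mesner[OF that] subspace_bose_mesner
      by (auto simp: matrix_add_ldistrib matrix_scalar_ac scalar_matrix_assoc[symmetric]
          intro!: subspace_add subspace_scale)
  qed
  show ?thesis
    using assms(1)[unfolded bose_mesner_def]
  proof (induction rule: span_induct_alt)
    case base
    show ?case using subspace_0[OF subspace_bose_mesner] by simp
  next
    case (step c A B)
    then show ?case
      using adj subspace_bose_mesner
      by (auto simp: matrix_mult_add_left scalar_matrix_assoc[symmetric]
          intro!: subspace_add subspace_scale)
  qed
qed

text \<open>The two factors and their product are symmetric, and transposition reverses
  products.\<close>

lemma bose_mesner_commute:
  assumes "M \<in> BM" "N \<in> BM"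
  shows "M ** N = N ** M"
proof -
  have "(M ** N) $ x $ y = (N ** M) $ y $ x" for x y
    unfolding matrix_matrix_mult_def
    by (simp add: mult.commute bose_mesner_sym[OF assms(1), of x] bose_mesner_sym[OF assms(2), of y])
  then show ?thesis
    using bose_mesner_sym[OF matrix_mult_in_bose_mesner[OF assms(2,1)]] by (simp add: vec_eq_iff)
qed

text \<open>In a commutative algebra \<open>e = e ** f + (e - e ** f)\<close> splits
  \<open>e\<close> into orthogonal idempotents. Primitivity of \<open>e\<close> leaves
  \<open>e ** f = 0\<close> or \<open>e ** f = e\<close>; exchanging the roles gives
  \<open>0\<close> or \<open>f\<close>, and \<open>e\<close> differs from \<open>f\<close>.\<close>

lemma primitive_idempotent_orthogonal:
  assumes e: "primitive_idempotent_in BM e" and f: "primitive_idempotent_in BM f"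
    and ne: "e \<noteq> f"
  shows "e ** f = 0"
proof -
  have mult_cases: "e ** f = 0 \<or> e ** f = e"
    if "primitive_idempotent_in BM e" "primitive_idempotent_in BM f" for e f
  proof (rule ccontr)
    assume "\<not> (e ** f = 0 \<or> e ** f = e)"
    then have ne: "e ** f \<noteq> 0" "e - e ** f \<noteq> 0" by auto
    have in_BM: "e \<in> BM" "f \<in> BM" and idem: "e ** e = e" "f ** f = f"
      using that by (auto simp: primitive_idempotent_in_def)
    have ef: "e ** f \<in> BM" "e - e ** f \<in> BM"
      using in_BM by (auto intro: matrix_mult_in_bose_mesner subspace_diff[OF subspace_bose_mesner])
    have 1: "e ** (e ** f) = e ** f"
      by (simp add: matrix_mul_assoc idem)
    have 2: "(e ** f) ** e = e ** f"
      using 1 bose_mesner_commute[OF in_BM(1) ef(1)] by simp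
    have 3: "(e ** f) ** (e ** f) = e ** f"
      by (metis 2 idem(2) matrix_mul_assoc)
    have 4: "(e - e ** f) ** (e - e ** f) = e - e ** f" "(e ** f) ** (e - e ** f) = 0"
      "(e - e ** f) ** (e ** f) = 0"
      by (simp_all add: matrix_mult_diff_left matrix_mult_diff_right idem 1 2 3)
    have "\<exists>g\<in>BM. \<exists>h\<in>BM. g \<noteq> 0 \<and> h \<noteq> 0 \<and> g ** g = g \<and> h ** h = h \<and>
        g ** h = 0 \<and> h ** g = 0 \<and> e = g + h"
      by (rule bexI[OF _ ef(1)], rule bexI[OF _ ef(2)]) (use ne 3 4 in simp)
    with that(1) show False unfolding primitive_idempotent_in_def by blast
  qed
  have "e ** f = f ** e"
    using e f by (auto simp: primitive_idempotent_in_def intro: bose_mesner_commute)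
  then show ?thesis using mult_cases[OF e f] mult_cases[OF f e] ne by auto
qed

section \<open>Triple products\<close>

definition triangle_invariant :: "('a \<Rightarrow> 'a \<Rightarrow> 'a \<Rightarrow> real) \<Rightarrow> bool" where
  "triangle_invariant f \<longleftrightarrow> (\<exists>c. \<forall>i\<le>D. \<forall>j\<le>D. \<forall>k\<le>D. \<forall>x y z.
     (x, y) \<in> R i \<longrightarrow> (y, z) \<in> R j \<longrightarrow> (z, x) \<in> R k \<longrightarrow> f x y z = c i j k)"

text \<open>The trilinear extension of the counts in triple regularity, which are its values at
  adjacency matrices.\<close>

definition triple_product :: "real^'a^'a \<Rightarrow> real^'a^'a \<Rightarrow> real^'a^'a \<Rightarrow> 'a \<Rightarrow> 'a \<Rightarrow> 'a \<Rightarrow> real" where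
  "triple_product A B C x y z = (\<Sum>u\<in>UNIV. A $ x $ u * B $ y $ u * C $ z $ u)"

lemma triangle_invariant_matrix:
  assumes "M \<in> BM"
  shows "triangle_invariant (\<lambda>x y z. M $ x $ y)"
proof -
  obtain m where "\<forall>i\<le>D. \<forall>x y. (x, y) \<in> R i \<longrightarrow> M $ x $ y = m i"
    using assms unfolding bose_mesner_iff by blast
  then show ?thesis
    unfolding triangle_invariant_def by (intro exI[of _ "\<lambda>i j k. m i"]) simp
qed

lemma triangle_invariant_rotate:
  assumes "triangle_invariant f"
  shows "triangle_invariant (\<lambda>x y z. f y z x)"
proof -
  obtain c where c: "\<forall>i\<le>D. \<forall>j\<le>D. \<forall>k\<le>D. \<forall>x y z.
     (x, y) \<in> R i \<longrightarrow> (y, z) \<in> R j \<longrightarrow> (z, x) \<in> R k \<longrightarrow> f x y z = c i j k"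
    using assms unfolding triangle_invariant_def by (rule exE)
  show ?thesis
    unfolding triangle_invariant_def
  proof (intro exI[of _ "\<lambda>i j k. c j k i"] allI impI)
    fix i j k x y z
    assume "i \<le> D" "j \<le> D" "k \<le> D" "(x, y) \<in> R i" "(y, z) \<in> R j" "(z, x) \<in> R k"
    then show "f y z x = c j k i"
      by (intro c[rule_format]) (simp_all add: R_sym)
  qed
qed

lemma triangle_invariant_combine:
  assumes "triangle_invariant f" "triangle_invariant f'"
  shows "triangle_invariant (\<lambda>x y z. h (f x y z) (f' x y z))"
proof -
  obtain c where c: "\<forall>i\<le>D. \<forall>j\<le>D. \<forall>k\<le>D. \<forall>x y z.
     (x, y) \<in> R i \<longrightarrow> (y, z) \<in> R j \<longrightarrow> (z, x) \<in> R k \<longrightarrow> f x y z = c i j k"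
    using assms(1) unfolding triangle_invariant_def by (rule exE)
  obtain c' where c': "\<forall>i\<le>D. \<forall>j\<le>D. \<forall>k\<le>D. \<forall>x y z.
     (x, y) \<in> R i \<longrightarrow> (y, z) \<in> R j \<longrightarrow> (z, x) \<in> R k \<longrightarrow> f' x y z = c' i j k"
    using assms(2) unfolding triangle_invariant_def by (rule exE)
  show ?thesis
    unfolding triangle_invariant_def
  proof (intro exI[of _ "\<lambda>i j k. h (c i j k) (c' i j k)"] allI impI)
    fix i j k x y z
    assume "i \<le> D" "j \<le> D" "k \<le> D" "(x, y) \<in> R i" "(y, z) \<in> R j" "(z, x) \<in> R k"
    then have "f x y z = c i j k" "f' x y z = c' i j k"
      by (intro c[rule_format] c'[rule_format]; simp)+
    then show "h (f x y z) (f' x y z) = h (c i j k) (c' i j k)" by simp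
  qed
qed

lemma triangle_invariant_const: "triangle_invariant (\<lambda>x y z. c)"
  unfolding triangle_invariant_def by (rule exI[of _ "\<lambda>_ _ _. c"]) simp

lemma triple_product_rotate:
  assumes "triangle_invariant (triple_product A B C)"
  shows "triangle_invariant (triple_product B C A)"
proof -
  have "triple_product B C A = (\<lambda>x y z. triple_product A B C z x y)"
    by (simp add: triple_product_def fun_eq_iff mult_ac)
  then show ?thesis
    using triangle_invariant_rotate[OF triangle_invariant_rotate[OF assms]] by simp
qed

lemma triple_product_span_left:
  assumes "\<And>A. A \<in> S \<Longrightarrow> triangle_invariant (triple_product A B C)" "A \<in> span S"
  shows "triangle_invariant (triple_product A B C)"
  using assms(2)
proof (induction rule: span_induct_alt)
  case base
  show ?case using triangle_invariant_const[of 0] by (simp add: triple_product_def[abs_def])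
next
  case (step c A M)
  have "triple_product (c *\<^sub>R A + M) B C
      = (\<lambda>x y z. c * triple_product A B C x y z + triple_product M B C x y z)"
    by (simp add: triple_product_def fun_eq_iff algebra_simps sum.distrib sum_distrib_left)
  then show ?case
    using triangle_invariant_combine[OF assms(1)[OF step(1)] step.IH, of "\<lambda>a b. c * a + b"] by simp
qed

text \<open>The three arguments are extended from \<open>S\<close> to its span one after the other;
  cyclic rotation brings each of them to the first place, where linearity applies.\<close>

lemma triple_product_span:
  assumes S: "\<And>A B C. A \<in> S \<Longrightarrow> B \<in> S \<Longrightarrow> C \<in> S \<Longrightarrow> triangle_invariant (triple_product A B C)"
    and "A \<in> span S" "B \<in> span S" "C \<in> span S"
  shows "triangle_invariant (triple_product A B C)"
proof -
  have 1: "triangle_invariant (triple_product A B' C')" if "B' \<in> S" "C' \<in> S" for B' C'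
    by (rule triple_product_span_left[OF _ assms(2)]) (rule S[OF _ that])
  have 2: "triangle_invariant (triple_product B C' A)" if "C' \<in> S" for C'
    by (rule triple_product_span_left[OF _ assms(3)]) (rule triple_product_rotate[OF 1[OF _ that]])
  show ?thesis
    by (rule triple_product_rotate,
        rule triple_product_span_left[OF _ assms(4)], rule triple_product_rotate, rule 2)
qed

lemma triple_product_adj_matrix:
  "triple_product (adj_matrix q) (adj_matrix r) (adj_matrix s) x y z
    = real (card (q `` {x} \<inter> r `` {y} \<inter> s `` {z}))"
proof -
  have "triple_product (adj_matrix q) (adj_matrix r) (adj_matrix s) x y z
      = (\<Sum>u\<in>UNIV. if u \<in> q `` {x} \<inter> r `` {y} \<inter> s `` {z} then 1 else 0)"
    unfolding triple_product_def by (intro sum.cong) (auto simp: adj_matrix_nth)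
  also have "\<dots> = real (card (q `` {x} \<inter> r `` {y} \<inter> s `` {z}))"
    using sum.If_cases[of "UNIV :: 'a set" "\<lambda>u. u \<in> q `` {x} \<inter> r `` {y} \<inter> s `` {z}" "\<lambda>_. 1" "\<lambda>_. 0 :: real"]
    by (simp only: finite Collect_mem_eq Int_UNIV_left sum.neutral_const add_0_right sum_constant mult_1_right)
  finally show ?thesis .
qed

lemma triply_regular_iff:
  "triply_regular D R \<longleftrightarrow>
    (\<forall>A\<in>BM. \<forall>B\<in>BM. \<forall>C\<in>BM. triangle_invariant (triple_product A B C))"
proof
  assume tr: "triply_regular D R"
  have adj: "triangle_invariant (triple_product (adj_matrix (R m)) (adj_matrix (R k)) (adj_matrix (R l)))"
    if "m \<le> D" "k \<le> D" "l \<le> D" for m k l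
  proof -
    \<comment> \<open>The count is given separately for each type of triangle, so a choice is made
      to obtain one function of the type.\<close>
    define P where "P i j h p \<longleftrightarrow> (\<forall>x y z. (x, y) \<in> R i \<longrightarrow> (y, z) \<in> R j \<longrightarrow> (z, x) \<in> R h \<longrightarrow>
        card (R m `` {x} \<inter> R k `` {y} \<inter> R l `` {z}) = p)" for i j h p
    have "P i j h (SOME p. P i j h p)" if "i \<le> D" "j \<le> D" "h \<le> D" for i j h
    proof (rule someI_ex)
      show "\<exists>p. P i j h p"
        using tr that \<open>m \<le> D\<close> \<open>k \<le> D\<close> \<open>l \<le> D\<close> unfolding triply_regular_def P_def by simp
    qed
    then show ?thesis
      unfolding triangle_invariant_def triple_product_adj_matrix
      by (intro exI[of _ "\<lambda>i j h. real (SOME p. P i j h p)"]) (simp add: P_def)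
  qed
  show "\<forall>A\<in>BM. \<forall>B\<in>BM. \<forall>C\<in>BM. triangle_invariant (triple_product A B C)"
  proof (intro ballI)
    fix A B C assume "A \<in> BM" "B \<in> BM" "C \<in> BM"
    then show "triangle_invariant (triple_product A B C)"
      unfolding bose_mesner_def by (rule triple_product_span[rotated]) (use adj in auto)
  qed
next
  assume inv: "\<forall>A\<in>BM. \<forall>B\<in>BM. \<forall>C\<in>BM. triangle_invariant (triple_product A B C)"
  show "triply_regular D R"
    unfolding triply_regular_def
  proof (intro allI impI)
    fix i j k l m p
    assume le: "i \<le> D" "j \<le> D" "k \<le> D" "l \<le> D" "m \<le> D" "p \<le> D"
    have "triangle_invariant (triple_product (adj_matrix (R m)) (adj_matrix (R p)) (adj_matrix (R l)))"
      using inv le adj_matrix_in_bose_mesner by blast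
    then obtain c where "\<forall>i\<le>D. \<forall>j\<le>D. \<forall>k\<le>D. \<forall>x y z.
        (x, y) \<in> R i \<longrightarrow> (y, z) \<in> R j \<longrightarrow> (z, x) \<in> R k \<longrightarrow>
        real (card (R m `` {x} \<inter> R p `` {y} \<inter> R l `` {z})) = c i j k"
      unfolding triangle_invariant_def triple_product_adj_matrix by (rule exE)
    with le have c: "\<forall>x y z. (x, y) \<in> R i \<longrightarrow> (y, z) \<in> R j \<longrightarrow> (z, x) \<in> R k \<longrightarrow>
        real (card (R m `` {x} \<inter> R p `` {y} \<inter> R l `` {z})) = c i j k" by simp
    show "\<exists>q. \<forall>x y z. (x, y) \<in> R i \<longrightarrow> (y, z) \<in> R j \<longrightarrow> (z, x) \<in> R k \<longrightarrow>
        card (R m `` {x} \<inter> R p `` {y} \<inter> R l `` {z}) = q"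
    \<comment> \<open>The real value \<open>c i j k\<close> is a count as soon as a triangle of this
      type exists; otherwise any natural number will do.\<close>
    proof (intro exI[of _ "nat \<lfloor>c i j k\<rfloor>"] allI impI)
      fix x y z assume "(x, y) \<in> R i" "(y, z) \<in> R j" "(z, x) \<in> R k"
      with c have "real (card (R m `` {x} \<inter> R p `` {y} \<inter> R l `` {z})) = c i j k" by simp
      then show "card (R m `` {x} \<inter> R p `` {y} \<inter> R l `` {z}) = nat \<lfloor>c i j k\<rfloor>" by linarith
    qed
  qed
qed

end

section \<open>Primitive idempotents and Krein numbers\<close>

locale ordered_scheme = scheme D R
  for D :: nat and R :: "nat \<Rightarrow> ('a::finite) rel" +
  fixes E :: "nat \<Rightarrow> real^'a^'a"
  assumes ordering: "primitive_idempotent_ordering D R E"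
begin

definition n :: real where "n = real CARD('a)"

lemma n_pos: "n > 0"
  by (simp add: n_def)

lemma E_primitive: "i \<le> D \<Longrightarrow> primitive_idempotent_in BM (E i)"
  using ordering by (auto simp: primitive_idempotent_ordering_def bij_betw_def)

lemma E_inj: "inj_on E {..D}"
  using ordering by (simp add: primitive_idempotent_ordering_def bij_betw_def)

lemma E_0_nth: "E 0 $ x $ y = 1 / n"
  using ordering by (simp add: primitive_idempotent_ordering_def n_def)

lemma E_in_BM: "i \<le> D \<Longrightarrow> E i \<in> BM"
  using E_primitive[of i] by (simp add: primitive_idempotent_in_def)

lemma E_nonzero: "i \<le> D \<Longrightarrow> E i \<noteq> 0"
  using E_primitive[of i] by (simp add: primitive_idempotent_in_def)

lemma E_mult:
  assumes "i \<le> D" "j \<le> D"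
  shows "E i ** E j = (if i = j then E i else 0)"
proof (cases "i = j")
  case True
  then show ?thesis using E_primitive[OF assms(1)] by (simp add: primitive_idempotent_in_def)
next
  case False
  then have "E i \<noteq> E j" using E_inj assms by (auto dest: inj_onD)
  then show ?thesis
    using primitive_idempotent_orthogonal[OF E_primitive[OF assms(1)] E_primitive[OF assms(2)]] False
    by simp
qed

lemma E_row_orthogonal:
  assumes "i \<le> D" "j \<le> D"
  shows "(\<Sum>u\<in>UNIV. E i $ x $ u * E j $ y $ u) = (if i = j then E i $ x $ y else 0)"
proof -
  have "(\<Sum>u\<in>UNIV. E i $ x $ u * E j $ y $ u) = (E i ** E j) $ x $ y"
    unfolding matrix_matrix_mult_def by (simp add: bose_mesner_sym[OF E_in_BM[OF assms(2)], of y])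
  then show ?thesis using E_mult[OF assms] by simp
qed

lemma E_inner:
  assumes "i \<le> D" "j \<le> D"
  shows "E i \<bullet> E j = (if i = j then \<Sum>x\<in>UNIV. E i $ x $ x else 0)"
  using E_row_orthogonal[OF assms] by (simp add: inner_vec_def)

lemma E_inner_pos: "i \<le> D \<Longrightarrow> E i \<bullet> E i > 0"
  using E_nonzero by simp

text \<open>The diagonal is constant because \<open>R 0\<close> is the identity relation, and
  \<open>E i \<bullet> E i\<close> is the trace of \<open>E i\<close>, that is, its rank: the
  multiplicity m_i.\<close>

lemma E_diag:
  assumes "i \<le> D"
  shows "n * E i $ x $ x = E i \<bullet> E i"
proof -
  obtain m where m: "\<forall>j\<le>D. \<forall>x y. (x, y) \<in> R j \<longrightarrow> E i $ x $ y = m j"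
    using E_in_BM[OF assms] unfolding bose_mesner_iff by blast
  have "E i $ y $ y = m 0" for y
    using m R_0 by auto
  then have "(\<Sum>y\<in>UNIV. E i $ y $ y) = (\<Sum>y\<in>(UNIV::'a set). E i $ x $ x)"
    by (simp only:)
  then show ?thesis using E_inner[OF assms assms] by (simp add: n_def)
qed

lemma E_0_inner: "E 0 \<bullet> E 0 = 1"
  using E_diag[of 0] E_0_nth n_pos by simp

text \<open>A dimension count: the algebra is spanned by \<open>D + 1\<close> matrices and contains
  the \<open>D + 1\<close> nonzero, pairwise orthogonal matrices \<open>E k\<close>.\<close>

lemma BM_eq_span: "BM = span (E ` {..D})"
proof
  have "pairwise orthogonal (E ` {..D})"
    by (auto simp: pairwise_def orthogonal_def E_inner)
  moreover have "0 \<notin> E ` {..D}" using E_nonzero by force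
  ultimately have ind: "independent (E ` {..D})" by (rule pairwise_orthogonal_independent)
  have sub: "E ` {..D} \<subseteq> BM" using E_in_BM by auto
  have "dim BM \<le> card ((\<lambda>i. adj_matrix (R i)) ` {..D})"
    by (rule dim_le_card) (simp_all add: bose_mesner_def)
  also have "\<dots> \<le> card {..D}" by (rule card_image_le) simp
  also have "\<dots> = card (E ` {..D})" using E_inj by (simp add: card_image)
  finally show "BM \<subseteq> span (E ` {..D})" using card_ge_dim_independent[OF sub ind] by simp
  show "span (E ` {..D}) \<subseteq> BM" using sub subspace_bose_mesner by (rule span_minimal)
qed

lemma E_expansion:
  assumes "M \<in> BM"
  shows "M = (\<Sum>k\<le>D. (M \<bullet> E k / (E k \<bullet> E k)) *\<^sub>R E k)"
  using assms[unfolded BM_eq_span]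
proof (induction rule: span_induct_alt)
  case base
  show ?case by simp
next
  case (step c A M)
  then obtain j where j: "j \<le> D" "A = E j" by auto
  have "(\<Sum>k\<le>D. (E j \<bullet> E k / (E k \<bullet> E k)) *\<^sub>R E k) = (\<Sum>k\<le>D. if k = j then E j else 0)"
  proof (rule sum.cong[OF refl])
    fix k assume "k \<in> {..D}"
    then show "(E j \<bullet> E k / (E k \<bullet> E k)) *\<^sub>R E k = (if k = j then E j else 0)"
      using j(1) E_inner[of j k] E_nonzero[of j] by auto
  qed
  then have "c *\<^sub>R A + M = c *\<^sub>R (\<Sum>k\<le>D. (A \<bullet> E k / (E k \<bullet> E k)) *\<^sub>R E k)
      + (\<Sum>k\<le>D. (M \<bullet> E k / (E k \<bullet> E k)) *\<^sub>R E k)"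
    using j step.IH by simp
  then show ?case
    by (rule trans)
      (simp add: inner_add_left add_divide_distrib scaleR_add_left sum.distrib scaleR_sum_right)
qed

text \<open>The inner product of the identity with \<open>E k\<close> is the trace of
  \<open>E k\<close>, so all coefficients in the orthogonal expansion are 1.\<close>

lemma sum_E: "(\<Sum>k\<le>D. E k) = mat 1"
proof -
  have "mat 1 \<bullet> E k = E k \<bullet> E k" if "k \<le> D" for k
  proof -
    have "mat 1 \<bullet> E k = (\<Sum>x\<in>UNIV. \<Sum>y\<in>UNIV. if x = y then E k $ x $ y else 0)"
      by (simp add: inner_vec_def mat_def if_distrib[of "\<lambda>c. c * _"] cong: if_cong)
    then show ?thesis using E_inner[OF that that] by simp
  qed
  then have "(\<Sum>k\<le>D. (mat 1 \<bullet> E k / (E k \<bullet> E k)) *\<^sub>R E k) = (\<Sum>k\<le>D. E k)"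
    using E_inner_pos by (intro sum.cong) auto
  then show ?thesis using E_expansion[OF mat_1_in_bose_mesner] by simp
qed

text \<open>Orthogonality of the \<open>E k\<close> makes the coefficients unique, and pairing with
  \<open>E k\<close> computes them. In this form the symmetry of
  \<open>(E i * E j) \<bullet> E k\<close> in the three indices can be exploited.\<close>

lemma krein_eq:
  assumes "i \<le> D" "j \<le> D" "k \<le> D"
  shows "krein D E i j k = n * ((E i * E j) \<bullet> E k) / (E k \<bullet> E k)"
proof -
  let ?q = "\<lambda>k. if k \<le> D then n * ((E i * E j) \<bullet> E k) / (E k \<bullet> E k) else 0"
  have "krein D E i j = ?q"
    unfolding krein_def
  proof (rule the_equality)
    have "E i * E j = (\<Sum>k\<le>D. ((E i * E j) \<bullet> E k / (E k \<bullet> E k)) *\<^sub>R E k)"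
      using assms E_in_BM by (intro E_expansion hadamard_in_bose_mesner) auto
    also have "\<dots> = (1 / n) *\<^sub>R (\<Sum>k\<le>D. ?q k *\<^sub>R E k)"
      unfolding scaleR_sum_right using n_pos by (intro sum.cong) auto
    finally show "(\<forall>k>D. ?q k = 0) \<and>
        E i * E j = (1 / real CARD('a)) *\<^sub>R (\<Sum>k\<le>D. ?q k *\<^sub>R E k)"
      by (simp add: n_def)
  next
    fix q
    assume q: "(\<forall>k>D. q k = 0) \<and> E i * E j = (1 / real CARD('a)) *\<^sub>R (\<Sum>k\<le>D. q k *\<^sub>R E k)"
    have "q k = ?q k" if "k \<le> D" for k
    proof -
      have "n * ((E i * E j) \<bullet> E k) = (\<Sum>l\<le>D. q l * (E l \<bullet> E k))"
        using q n_pos by (simp add: n_def inner_sum_left)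
      also have "\<dots> = (\<Sum>l\<le>D. if l = k then q k * (E k \<bullet> E k) else 0)"
        using that by (intro sum.cong) (auto simp: E_inner)
      finally show ?thesis using that E_inner_pos[OF that] by (simp add: field_simps)
    qed
    then show "q = ?q" using q by (auto simp: fun_eq_iff)
  qed
  then show ?thesis using assms by simp
qed

end

section \<open>Linked simplices\<close>

text \<open>Here \<open>g\<close> is the indicator of an equivalence relation with classes (fibres)
  of size \<open>v\<close>. By \<open>th_sym\<close> and \<open>th_conv\<close> the matrix
  \<open>th / n\<close> is an orthogonal projection, so \<open>th\<close> is a Gram matrix. In a
  fibre the vectors have squared norm \<open>v - 1\<close> and mutual inner products
  \<open>- 1\<close> by \<open>th_fibre\<close>, and they sum to zero by
  \<open>th_row\<close>.\<close>

locale linked_simplices =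
  fixes g th :: "'a::finite \<Rightarrow> 'a \<Rightarrow> real" and v n :: real
  assumes n_def: "n = real CARD('a)"
    and v_pos: "v > 0"
    and g_01: "g x y = 0 \<or> g x y = 1"
    and g_refl: "g x x = 1"
    and g_sym: "g x y = g y x"
    and g_trans: "g x y * g x z = g x y * g y z"
    and g_row: "(\<Sum>u\<in>UNIV. g x u) = v"
    and th_sym: "th x y = th y x"
    and th_fibre: "g x y * th x y = v * of_bool (x = y) - g x y"
    and th_row: "(\<Sum>u\<in>UNIV. g x u * th y u) = 0"
    and th_conv: "(\<Sum>u\<in>UNIV. th x u * th y u) = n * th x y"
begin

lemma n_pos: "n > 0"
  by (simp add: n_def)

lemma th_diag: "th x x = v - 1"
  using th_fibre[of x x] g_refl[of x] by simp

lemma th_in_fibre: "g x y = 1 \<Longrightarrow> x \<noteq> y \<Longrightarrow> th x y = - 1"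
  using th_fibre[of x y] by simp

text \<open>For \<open>y\<close> in the fibre, \<open>th y p\<close> is \<open>v\<close> times a
  delta minus 1; the constant part is killed by \<open>th_row\<close>.\<close>

lemma fibre_conv_mem:
  assumes "g f y = 1"
  shows "(\<Sum>p\<in>UNIV. g f p * th y p * th p u) = v * th y u"
proof -
  have "g f p * th y p * th p u = v * (of_bool (y = p) * th p u) - g y p * th u p" for p
  proof -
    have "g f p = g y p" using g_trans[of f y p] assms by simp
    then have "g f p * th y p * th p u = (g y p * th y p) * th p u" by simp
    also have "\<dots> = (v * of_bool (y = p) - g y p) * th p u" by (simp only: th_fibre)
    finally show ?thesis by (simp add: th_sym[of u p] algebra_simps)
  qed
  then have "(\<Sum>p\<in>UNIV. g f p * th y p * th p u)
      = v * (\<Sum>p\<in>UNIV. of_bool (y = p) * th p u) - (\<Sum>p\<in>UNIV. g y p * th u p)"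
    by (simp only: sum_subtractf sum_distrib_left)
  moreover have "(\<Sum>p\<in>UNIV. of_bool (y = p) * th p u) = (\<Sum>p\<in>UNIV. if y = p then th p u else 0)"
    by (intro sum.cong) auto
  ultimately show ?thesis by (simp add: th_row)
qed

text \<open>The vectors with Gram matrix \<^term>\<open>th\<close> that belong to one fibre form a regular simplex
  spanning the whole space. The squared norms of the residuals of the other vectors are nonnegative and,
  summed over all fibres, vanish by the global identity \<open>th_conv\<close>.\<close>

lemma fibre_conv: "(\<Sum>p\<in>UNIV. g f p * th y p * th p u) = v * th y u"
proof -
  \<comment> \<open>Up to the factor \<open>v\<close>, this is the inner product of \<open>u\<close>
    with the projection of the vector \<open>y\<close> to the span of the fibre of
    \<open>f\<close>.\<close>
  define H where "H f u = (\<Sum>p\<in>UNIV. g f p * th y p * th p u)" for f u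
  have H_conv: "(\<Sum>u\<in>UNIV. th q u * H f u) = n * H f q" for f q
  proof -
    have "(\<Sum>u\<in>UNIV. th q u * H f u) = (\<Sum>u\<in>UNIV. \<Sum>p\<in>UNIV. g f p * th y p * (th q u * th p u))"
      by (simp add: H_def sum_distrib_left mult_ac)
    also have "\<dots> = (\<Sum>p\<in>UNIV. g f p * th y p * (\<Sum>u\<in>UNIV. th q u * th p u))"
      by (subst sum.swap) (simp add: sum_distrib_left)
    also have "\<dots> = (\<Sum>p\<in>UNIV. g f p * th y p * (n * th q p))"
      by (simp only: th_conv)
    also have "\<dots> = n * H f q"
      by (simp add: H_def sum_distrib_left mult_ac th_sym[of q])
    finally show ?thesis .
  qed
  have H_fibre: "g f q * H f q = v * (g f q * th y q)" for f q
  proof (cases "g f q = 1")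
    case True
    have "H f q = (\<Sum>p\<in>UNIV. g f p * th q p * th p y)"
      unfolding H_def by (intro sum.cong refl) (simp add: th_sym[of q] th_sym[of y])
    then show ?thesis using fibre_conv_mem[OF True] by (simp add: th_sym[of y])
  next
    case False
    then show ?thesis using g_01[of f q] by simp
  qed
  \<comment> \<open>Only one factor is expanded: \<open>H_conv\<close> then removes the sum over
    \<open>u\<close>, and \<open>H_fibre\<close> says that the projection preserves inner products
    with vectors of the fibre.\<close>
  have H_sq: "(\<Sum>u\<in>UNIV. H f u * H f u) = n * v * H f y" for f
  proof -
    have "(\<Sum>u\<in>UNIV. H f u * H f u)
        = (\<Sum>u\<in>UNIV. (\<Sum>q\<in>UNIV. g f q * th y q * th q u) * H f u)"
      by (simp only: H_def[of f])
    also have "\<dots> = (\<Sum>u\<in>UNIV. \<Sum>q\<in>UNIV. g f q * th y q * (th q u * H f u))"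
      by (simp only: sum_distrib_right mult.assoc)
    also have "\<dots> = (\<Sum>q\<in>UNIV. g f q * th y q * (\<Sum>u\<in>UNIV. th q u * H f u))"
      by (subst sum.swap) (simp only: sum_distrib_left)
    also have "\<dots> = (\<Sum>q\<in>UNIV. n * th y q * (g f q * H f q))"
      by (simp only: H_conv) (simp only: mult_ac)
    also have "\<dots> = (\<Sum>q\<in>UNIV. n * th y q * (v * (g f q * th y q)))"
      by (simp only: H_fibre)
    also have "\<dots> = n * v * (\<Sum>q\<in>UNIV. g f q * th y q * th q y)"
      by (simp add: sum_distrib_left mult_ac th_sym[of y])
    finally show ?thesis by (simp only: H_def)
  qed
  have res: "(\<Sum>u\<in>UNIV. (v * th y u - H f u)^2) = n * v * (v * (v - 1) - H f y)" for f
  proof -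
    have "(v * th y u - H f u)^2
        = v^2 * (th y u * th y u) - 2 * v * (th y u * H f u) + H f u * H f u" for u
      by (simp add: power2_eq_square algebra_simps)
    then have "(\<Sum>u\<in>UNIV. (v * th y u - H f u)^2)
        = v^2 * (\<Sum>u\<in>UNIV. th y u * th y u) - 2 * v * (\<Sum>u\<in>UNIV. th y u * H f u)
          + (\<Sum>u\<in>UNIV. H f u * H f u)"
      by (simp add: sum.distrib sum_subtractf sum_distrib_left)
    also have "\<dots> = v^2 * (n * (v - 1)) - 2 * v * (n * H f y) + n * v * H f y"
      by (simp only: th_conv H_conv H_sq th_diag)
    finally show ?thesis by (simp add: power2_eq_square algebra_simps)
  qed
  \<comment> \<open>Each \<open>p\<close> lies in the fibre of exactly \<open>v\<close> labels
    \<open>f\<close>. Hence the average of \<open>H f y\<close> over \<open>f\<close> is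
    \<open>v * (v - 1)\<close>, the value at which the residual in \<open>res\<close>
    vanishes.\<close>
  have "(\<Sum>f\<in>UNIV. H f y) = (\<Sum>p\<in>UNIV. th y p * th y p * (\<Sum>f\<in>UNIV. g p f))"
    unfolding H_def by (subst sum.swap) (simp add: sum_distrib_left mult_ac th_sym[of y] g_sym)
  also have "\<dots> = n * v * (v - 1)"
    by (simp add: g_row sum_distrib_right[symmetric] th_conv th_diag)
  finally have "(\<Sum>f\<in>UNIV. \<Sum>u\<in>UNIV. (v * th y u - H f u)^2) = 0"
    by (simp add: res sum_distrib_left[symmetric] sum_subtractf n_def)
  then have "(\<Sum>u\<in>UNIV. (v * th y u - H f u)^2) = 0"
    by (subst (asm) sum_nonneg_eq_0_iff) (auto intro: sum_nonneg)
  then have "(v * th y u - H f u)^2 = 0"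
    by (subst (asm) sum_nonneg_eq_0_iff) auto
  then show ?thesis by (simp add: H_def)
qed

section \<open>The cubic form of the vector system\<close>

definition cubic :: "'a \<Rightarrow> 'a \<Rightarrow> 'a \<Rightarrow> real" where
  "cubic x y z = (\<Sum>u\<in>UNIV. th x u * th y u * th z u)"

lemma cubic_swap: "cubic x y z = cubic y x z" and cubic_rotate: "cubic x y z = cubic y z x"
  by (simp_all add: cubic_def mult_ac)

text \<open>The form is linear in the vector \<open>z\<close>, and by \<open>fibre_conv\<close> this
  vector is \<open>1 / v\<close> times the sum of \<open>th z p\<close> times the vector
  \<open>p\<close> over any one fibre.\<close>

lemma cubic_expand: "v * cubic x y z = (\<Sum>p\<in>UNIV. g f p * th z p * cubic x y p)"
proof -
  have "v * cubic x y z = (\<Sum>u\<in>UNIV. th x u * th y u * (v * th z u))"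
    by (simp add: cubic_def sum_distrib_left mult_ac)
  also have "\<dots> = (\<Sum>u\<in>UNIV. \<Sum>p\<in>UNIV. g f p * th z p * (th x u * th y u * th p u))"
    by (simp only: fibre_conv[of f, symmetric] sum_distrib_left mult_ac)
  also have "\<dots> = (\<Sum>p\<in>UNIV. g f p * th z p * cubic x y p)"
    by (subst sum.swap) (simp add: cubic_def sum_distrib_left)
  finally show ?thesis .
qed

lemma cubic_row: "(\<Sum>p\<in>UNIV. g f p * cubic x y p) = 0"
proof -
  have "(\<Sum>p\<in>UNIV. g f p * cubic x y p)
      = (\<Sum>u\<in>UNIV. th x u * th y u * (\<Sum>p\<in>UNIV. g f p * th u p))"
    unfolding cubic_def sum_distrib_left
    by (subst sum.swap) (simp add: mult_ac th_sym)
  then show ?thesis by (simp add: th_row)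
qed

lemma sum_delta_of_bool: "(\<Sum>p\<in>UNIV. f p * of_bool (p = y)) = (f (y::'a) :: real)"
  by (simp add: of_bool_def if_distrib[of "\<lambda>c. _ * c"] cong: if_cong)

text \<open>Summing out the vertex \<open>y\<close> replaces the path from \<open>u\<close> through
  \<open>y\<close> to \<open>w\<close> by the edge \<open>th u w\<close>, at the cost of a factor
  \<open>n\<close>.\<close>

lemma th_conv_weighted:
  "(\<Sum>y\<in>UNIV. \<Sum>u\<in>UNIV. \<Sum>w\<in>UNIV. F u w * (th y u * th y w))
    = n * (\<Sum>u\<in>UNIV. \<Sum>w\<in>UNIV. F u w * th u w)"
proof -
  have "(\<Sum>y\<in>UNIV. \<Sum>u\<in>UNIV. \<Sum>w\<in>UNIV. F u w * (th y u * th y w))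
      = (\<Sum>u\<in>UNIV. \<Sum>y\<in>UNIV. \<Sum>w\<in>UNIV. F u w * (th y u * th y w))"
    by (rule sum.swap)
  also have "\<dots> = (\<Sum>u\<in>UNIV. \<Sum>w\<in>UNIV. \<Sum>y\<in>UNIV. F u w * (th y u * th y w))"
    by (intro sum.cong refl sum.swap)
  also have "\<dots> = (\<Sum>u\<in>UNIV. \<Sum>w\<in>UNIV. F u w * (\<Sum>y\<in>UNIV. th u y * th w y))"
    by (simp only: sum_distrib_left th_sym)
  also have "\<dots> = (\<Sum>u\<in>UNIV. \<Sum>w\<in>UNIV. n * (F u w * th u w))"
    by (simp only: th_conv mult.left_commute)
  finally show ?thesis by (simp only: sum_distrib_left)
qed

text \<open>Squaring doubles the inner vertex into \<open>u\<close> and \<open>w\<close>. Summing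
  out \<open>z\<close>, \<open>y\<close> and \<open>x\<close> in turn yields
  \<open>n * th u w\<close> each time, and \<open>cubic u u u\<close> is the sum of the cubes of
  \<open>th u w\<close> over \<open>w\<close>.\<close>

lemma cubic_sum_sq:
  "(\<Sum>x\<in>UNIV. \<Sum>y\<in>UNIV. \<Sum>z\<in>UNIV. (cubic x y z)^2) = n^3 * (\<Sum>u\<in>UNIV. cubic u u u)"
proof -
  have "(\<Sum>z\<in>UNIV. (cubic x y z)^2) = n * (\<Sum>u\<in>UNIV. \<Sum>w\<in>UNIV.
      (th x u * th x w * th u w) * (th y u * th y w))" for x y
  proof -
    have "(cubic x y z)^2 = (\<Sum>u\<in>UNIV. \<Sum>w\<in>UNIV.
        (th x u * th x w * (th y u * th y w)) * (th z u * th z w))" for z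
      unfolding cubic_def power2_eq_square sum_product
      by (intro sum.cong refl) (simp only: mult_ac)
    then show ?thesis by (simp only: th_conv_weighted) (simp only: mult_ac)
  qed
  moreover have "(\<Sum>y\<in>UNIV. n * (\<Sum>u\<in>UNIV. \<Sum>w\<in>UNIV.
      (th x u * th x w * th u w) * (th y u * th y w)))
      = n^2 * (\<Sum>u\<in>UNIV. \<Sum>w\<in>UNIV. (th u w * th u w) * (th x u * th x w))" for x
    unfolding sum_distrib_left[symmetric] th_conv_weighted
    by (simp only: mult_ac power2_eq_square)
  moreover have "(\<Sum>x\<in>UNIV. n^2 * (\<Sum>u\<in>UNIV. \<Sum>w\<in>UNIV.
      (th u w * th u w) * (th x u * th x w))) = n^3 * (\<Sum>u\<in>UNIV. cubic u u u)"
    unfolding sum_distrib_left[symmetric] th_conv_weighted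
    by (simp add: cubic_def power2_eq_square power3_eq_cube)
  ultimately show ?thesis by simp
qed

lemma cubic_eq_0:
  assumes "(\<Sum>u\<in>UNIV. cubic u u u) = 0"
  shows "cubic x y z = 0"
proof -
  have "(\<Sum>x\<in>UNIV. \<Sum>y\<in>UNIV. \<Sum>z\<in>UNIV. (cubic x y z)^2) = 0"
    using assms by (simp add: cubic_sum_sq)
  then have "(\<Sum>y\<in>UNIV. \<Sum>z\<in>UNIV. (cubic x y z)^2) = 0"
    by (subst (asm) sum_nonneg_eq_0_iff) (auto intro!: sum_nonneg)
  then have "(\<Sum>z\<in>UNIV. (cubic x y z)^2) = 0"
    by (subst (asm) sum_nonneg_eq_0_iff) (auto intro!: sum_nonneg)
  then have "(cubic x y z)^2 = 0"
    by (subst (asm) sum_nonneg_eq_0_iff) auto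
  then show ?thesis by simp
qed

text \<open>Within one fibre \<^term>\<open>cubic\<close> is a multiple of the cubic form of the regular simplex, so it is
  determined everywhere by a single scalar; computing \<open>cubic x x y\<close> once from the fibre of \<open>x\<close> and
  once from the fibre of \<open>y\<close> leaves only the stated possibilities.\<close>

lemma cubic_const_on_fibres:
  assumes c0: "\<And>x. cubic x x x = c0"
    and c1: "\<And>x p. g x p = 1 \<Longrightarrow> x \<noteq> p \<Longrightarrow> cubic x x p = c1"
    and c2: "\<And>x p q. g x p = 1 \<Longrightarrow> g x q = 1 \<Longrightarrow> x \<noteq> p \<Longrightarrow> x \<noteq> q \<Longrightarrow> p \<noteq> q \<Longrightarrow> cubic x p q = c2"
    and nontrivial: "g y0 p0 = 1" "y0 \<noteq> p0"
    and xy: "g x y = 0"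
  shows "c0 = 0 \<or> th x y = - 1 \<or> th x y = v - 1"
proof -
  \<comment> \<open>Interpolation by coincidences among three points of a fibre: start from
    \<open>c2\<close>, add \<open>\<alpha>\<close> for each equality, and correct by
    \<open>\<beta>\<close> when all three agree, so that
    \<open>c2 + 3 * \<alpha> + \<beta> = c0\<close>.\<close>
  define \<alpha> where "\<alpha> = c1 - c2"
  define \<beta> where "\<beta> = c0 - 3 * c1 + 2 * c2"
  have in_fibre: "g y p * g y q * cubic y p q = g y p * g y q *
      (c2 + \<alpha> * of_bool (p = y) + \<alpha> * of_bool (q = y) + \<alpha> * of_bool (p = q)
        + \<beta> * (of_bool (p = y) * of_bool (q = y)))" for y p q
  proof (cases "g y p = 1 \<and> g y q = 1")
    case True
    have "cubic y p p = cubic p p y" by (rule cubic_rotate)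
    moreover have "cubic y p y = cubic y y p" using cubic_rotate[of y y p] cubic_rotate[of y p y] by simp
    moreover have "g p y = 1" using True g_sym[of p y] by simp
    ultimately show ?thesis
      using True c0[of y] c1[of y p] c1[of y q] c1[of p y] c2[of y p q]
      by (auto simp: \<alpha>_def \<beta>_def of_bool_def)
  next
    case False
    then show ?thesis using g_01[of y p] g_01[of y q] by auto
  qed
  have row: "g y p * (v * c2 + v * \<alpha> * of_bool (p = y) + 2 * \<alpha> + \<beta> * of_bool (p = y)) = 0" for y p
  proof -
    have "0 = g y p * (\<Sum>q\<in>UNIV. g y q * cubic y p q)" by (simp add: cubic_row)
    also have "\<dots> = (\<Sum>q\<in>UNIV. g y p * g y q * cubic y p q)" by (simp add: sum_distrib_left mult.assoc)
    also have "\<dots> = (\<Sum>q\<in>UNIV. g y p * (c2 * g y q + \<alpha> * of_bool (p = y) * g y q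
        + \<alpha> * (g y q * of_bool (q = y)) + \<alpha> * (g y q * of_bool (q = p))
        + \<beta> * of_bool (p = y) * (g y q * of_bool (q = y))))"
      by (simp only: in_fibre) (simp add: algebra_simps eq_commute)
    also have "\<dots> = g y p * (c2 * v + \<alpha> * of_bool (p = y) * v + \<alpha> * g y y + \<alpha> * g y p
        + \<beta> * of_bool (p = y) * g y y)"
      by (simp only: sum_distrib_left[symmetric] sum.distrib sum_delta_of_bool g_row)
    also have "\<dots> = g y p * (v * c2 + v * \<alpha> * of_bool (p = y) + 2 * \<alpha> + \<beta> * of_bool (p = y))"
      using g_01[of y p] by (auto simp: g_refl)
    finally show ?thesis by simp
  qed
  \<comment> \<open>The fibre vectors sum to zero. This is read off once at a point other than the
    base point, which needs a fibre with two points, and once at the base point.\<close>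
  have eq1: "v * c2 + 2 * \<alpha> = 0" using row[of y0 p0] nontrivial by simp
  have eq2: "\<beta> = - v * \<alpha>" using row[of y y] eq1 by (simp add: g_refl algebra_simps)
  let ?s = "th x y"
  \<comment> \<open>Both copies of \<open>x\<close> are expanded over the fibre of \<open>y\<close>.
    The terms without enough deltas vanish by \<open>th_row\<close>; the one with
    \<open>p = q\<close> gives the squared norm of \<open>x\<close> by \<open>fibre_conv\<close>,
    and the one with \<open>p = q = y\<close> gives the square of \<open>?s\<close>.\<close>
  have from_y: "v * (v * cubic y x x) = \<alpha> * (v * (v - 1) - v * ?s^2)"
  proof -
    have "v * (v * cubic y x x) = (\<Sum>q\<in>UNIV. g y q * th x q * (v * cubic y x q))"
      by (simp only: cubic_expand[of y x x y] sum_distrib_left mult_ac)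
    also have "\<dots> = (\<Sum>q\<in>UNIV. \<Sum>p\<in>UNIV. g y q * th x q * (g y p * th x p * cubic y q p))"
      by (simp only: cubic_swap[of y x] cubic_rotate[of x y] cubic_expand[of y q x y for q] sum_distrib_left)
    also have "\<dots> = (\<Sum>q\<in>UNIV. \<Sum>p\<in>UNIV. th x q * th x p * (g y q * g y p * cubic y q p))"
      by (simp only: mult_ac)
    also have "\<dots> = (\<Sum>q\<in>UNIV. g y q * th x q * (\<Sum>p\<in>UNIV. c2 * (g y p * th x p)
        + \<alpha> * of_bool (q = y) * (g y p * th x p) + \<alpha> * ((g y p * th x p) * of_bool (p = y))
        + \<alpha> * ((g y p * th x p) * of_bool (p = q))
        + \<beta> * of_bool (q = y) * ((g y p * th x p) * of_bool (p = y))))"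
      unfolding in_fibre sum_distrib_left
      by (intro sum.cong refl) (simp add: algebra_simps eq_commute)
    also have "\<dots> = (\<Sum>q\<in>UNIV. \<alpha> * ?s * (g y q * th x q) + \<alpha> * (g y q * g y q * th x q * th x q)
        + \<beta> * ?s * ((g y q * th x q) * of_bool (q = y)))"
    proof (rule sum.cong[OF refl])
      fix q
      show "g y q * th x q * (\<Sum>p\<in>UNIV. c2 * (g y p * th x p)
          + \<alpha> * of_bool (q = y) * (g y p * th x p) + \<alpha> * ((g y p * th x p) * of_bool (p = y))
          + \<alpha> * ((g y p * th x p) * of_bool (p = q))
          + \<beta> * of_bool (q = y) * ((g y p * th x p) * of_bool (p = y)))
        = \<alpha> * ?s * (g y q * th x q) + \<alpha> * (g y q * g y q * th x q * th x q)
          + \<beta> * ?s * ((g y q * th x q) * of_bool (q = y))"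
        unfolding sum.distrib sum_distrib_left[symmetric] sum_delta_of_bool th_row
        by (simp add: g_refl algebra_simps)
    qed
    also have "\<dots> = \<alpha> * (\<Sum>q\<in>UNIV. g y q * th x q * th q x) + \<beta> * ?s^2"
    proof -
      have "g y q * g y q * th x q * th x q = g y q * th x q * th q x" for q
        using g_01[of y q] th_sym[of x q] by auto
      then show ?thesis
        by (simp only: sum.distrib sum_distrib_left[symmetric] sum_delta_of_bool th_row g_refl)
          (simp add: power2_eq_square)
    qed
    also have "\<dots> = \<alpha> * (v * (v - 1)) + \<beta> * ?s^2"
      by (simp only: fibre_conv th_diag)
    finally show ?thesis using eq2 by (simp add: algebra_simps)
  qed
  \<comment> \<open>Now \<open>y\<close> is expanded over the fibre of \<open>x\<close>; the
    constant part \<open>c1\<close> contributes zero.\<close>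
  have from_x: "v * cubic x x y = (c0 - c1) * ?s"
  proof -
    have "v * cubic x x y = (\<Sum>p\<in>UNIV. g x p * th y p * cubic x x p)"
      by (rule cubic_expand)
    also have "\<dots> = (\<Sum>p\<in>UNIV. c1 * (g x p * th y p) + (c0 - c1) * ((g x p * th y p) * of_bool (p = x)))"
    proof (rule sum.cong[OF refl])
      fix p
      show "g x p * th y p * cubic x x p
          = c1 * (g x p * th y p) + (c0 - c1) * ((g x p * th y p) * of_bool (p = x))"
        using g_01[of x p] c0[of x] c1[of x p] by (cases "p = x") (auto simp: algebra_simps)
    qed
    also have "\<dots> = (c0 - c1) * (g x x * th y x)"
      by (simp only: sum.distrib sum_distrib_left[symmetric] sum_delta_of_bool th_row)
    finally show ?thesis by (simp add: g_refl th_sym[of y])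
  qed
  \<comment> \<open>Equating the two values of \<open>cubic x x y\<close> gives
    \<open>\<alpha> * v\<close> times the quadratic \<open>?s^2 - (v - 2) * ?s - (v - 1)\<close>,
    which has the roots \<open>- 1\<close> and \<open>v - 1\<close>.\<close>
  have "v * (c0 - c1) = - v * \<alpha> * (v - 2)"
    using eq1 eq2 by (simp add: \<alpha>_def \<beta>_def) algebra
  moreover have "cubic y x x = cubic x x y" by (rule cubic_rotate)
  ultimately have "\<alpha> * (v * ((?s + 1) * (?s - (v - 1)))) = 0"
    using from_x from_y by algebra
  then consider "\<alpha> = 0" | "?s = - 1" | "?s = v - 1"
    using v_pos by auto
  then show ?thesis
  proof cases
    case 1
    then show ?thesis using eq1 eq2 v_pos by (simp add: \<alpha>_def \<beta>_def)
  qed simp_all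
qed

end

section \<open>Antipodal schemes with three classes\<close>

lemma sum_atMost_3: "(\<Sum>k\<le>3::nat. f k) = f 0 + f 1 + f 2 + (f 3 :: 'b::comm_monoid_add)"
  by (simp add: eval_nat_numeral)

locale antipodal_scheme = ordered_scheme 3 R E
  for R :: "nat \<Rightarrow> ('a::finite) rel" and E :: "nat \<Rightarrow> real^'a^'a" +
  assumes Q_poly: "Q_polynomial 3 E"
    and antipodal: "Q_antipodal_with 3 R E (R 0 \<union> R 2)"
begin

lemma Q_polyD:
  assumes "i \<le> 3"
  shows "\<exists>p. degree p = i \<and> (\<forall>x y. n * E i $ x $ y = poly p (n * E 1 $ x $ y))"
  using Q_poly[unfolded Q_polynomial_def, rule_format, OF assms] unfolding n_def .

lemma hadamard_E_0: "M * E 0 = (1 / n) *\<^sub>R M"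
  by (simp add: vec_eq_iff E_0_nth)

text \<open>Expand \<open>E 1 * E 3\<close> in the idempotents. The coefficient at
  \<open>E 0\<close> vanishes by orthogonality, at \<open>E 1\<close> by the degree of the
  polynomial for \<open>E 2\<close>, and at \<open>E 3\<close> by comparing diagonals; antipodality
  fixes the coefficient at \<open>E 2\<close>.\<close>

lemma hadamard_E_1_E_3: "E 2 = n *\<^sub>R (E 1 * E 3)"
proof -
  have pos: "E i \<bullet> E i > 0" if "i \<le> 3" for i using E_inner_pos that .
  have "Q_antipodal 3 E" using antipodal by (simp add: Q_antipodal_with_def)
  then have bc: "b_star 3 E j = c_star 3 E (3 - j)" if "j \<le> 3" "j \<noteq> 1" for j
    using that by (simp add: Q_antipodal_def)
  \<comment> \<open>The exceptional index is \<open>3 div 2 = 1\<close>. Index 2 gives the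
    coefficient at \<open>E 2\<close>; index 0, used below, gives m_1 m_3 = m_2 for the
    multiplicities.\<close>
  have "krein 3 E 1 3 2 = krein 3 E 1 0 1"
    using bc[of 2] by (simp add: b_star_def c_star_def)
  then have "n * ((E 1 * E 3) \<bullet> E 2) / (E 2 \<bullet> E 2) = 1"
    using n_pos pos[of 1] pos[of 2] by (auto simp: krein_eq hadamard_E_0)
  then have 2: "n * ((E 1 * E 3) \<bullet> E 2) = E 2 \<bullet> E 2"
    using pos[of 2] by (simp add: field_simps)
  have "krein 3 E 1 1 0 = krein 3 E 1 2 3"
    using bc[of 0] by (simp add: b_star_def c_star_def)
  moreover have "krein 3 E 1 1 0 = E 1 \<bullet> E 1"
    using n_pos by (simp add: krein_eq hadamard_inner hadamard_E_0 E_0_inner)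
  moreover have "krein 3 E 1 2 3 = n * ((E 1 * E 3) \<bullet> E 2) / (E 3 \<bullet> E 3)"
    by (simp add: krein_eq hadamard_inner mult.commute)
  ultimately have mult: "(E 1 \<bullet> E 1) * (E 3 \<bullet> E 3) = E 2 \<bullet> E 2"
    using 2 pos[of 3] by (simp add: field_simps)
  have 0: "(E 1 * E 3) \<bullet> E 0 = 0"
    by (simp add: hadamard_inner hadamard_E_0 E_inner)
  have 1: "(E 1 * E 3) \<bullet> E 1 = 0"
  proof -
    obtain p where p: "degree p = 2" "\<And>x y. n * E 2 $ x $ y = poly p (n * E 1 $ x $ y)"
      using Q_polyD[of 2] by auto
    have "n * E 2 $ x $ y = coeff p 0 + coeff p 1 * (n * E 1 $ x $ y)
        + coeff p 2 * (n^2 * (E 1 $ x $ y * E 1 $ x $ y))" for x y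
      unfolding p(2) by (simp add: poly_altdef p(1) numeral_2_eq_2 power2_eq_square)
    then have "n *\<^sub>R E 2 = (coeff p 0 * n) *\<^sub>R E 0 + (coeff p 1 * n) *\<^sub>R E 1
        + (coeff p 2 * n^2) *\<^sub>R (E 1 * E 1)"
      using n_pos by (simp add: vec_eq_iff E_0_nth)
    then have "(n *\<^sub>R E 2) \<bullet> E 3 = ((coeff p 0 * n) *\<^sub>R E 0 + (coeff p 1 * n) *\<^sub>R E 1
        + (coeff p 2 * n^2) *\<^sub>R (E 1 * E 1)) \<bullet> E 3" by (rule arg_cong)
    then have "coeff p 2 * n^2 * ((E 1 * E 1) \<bullet> E 3) = 0"
      by (simp add: inner_add_left E_inner)
    \<comment> \<open>Degree exactly 2 allows \<open>E 1 * E 1\<close> to be expressed by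
      \<open>E 0\<close>, \<open>E 1\<close> and \<open>E 2\<close>, all orthogonal to
      \<open>E 3\<close>.\<close>
    moreover have "coeff p 2 \<noteq> 0" using p(1) leading_coeff_neq_0[of p] by fastforce
    ultimately have "(E 1 * E 1) \<bullet> E 3 = 0" using n_pos by simp
    then show ?thesis by (simp add: hadamard_inner mult.commute)
  qed
  define q where "q = n * ((E 1 * E 3) \<bullet> E 3) / (E 3 \<bullet> E 3)"
  have exp: "n *\<^sub>R (E 1 * E 3) = E 2 + q *\<^sub>R E 3"
  proof -
    have "E 1 * E 3 = (\<Sum>k\<le>3. ((E 1 * E 3) \<bullet> E k / (E k \<bullet> E k)) *\<^sub>R E k)"
      by (intro E_expansion hadamard_in_bose_mesner E_in_BM) simp_all
    also have "\<dots> = ((E 1 * E 3) \<bullet> E 2 / (E 2 \<bullet> E 2)) *\<^sub>R E 2 + (q / n) *\<^sub>R E 3"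
      unfolding sum_atMost_3 0 1 q_def using n_pos by simp
    also have "(E 1 * E 3) \<bullet> E 2 / (E 2 \<bullet> E 2) = 1 / n"
      using 2 pos[of 2] n_pos by (simp add: field_simps)
    finally have "n *\<^sub>R (E 1 * E 3) = n *\<^sub>R ((1 / n) *\<^sub>R E 2 + (q / n) *\<^sub>R E 3)" by simp
    then show ?thesis using n_pos by (simp add: scaleR_add_right)
  qed
  \<comment> \<open>On the diagonal the expansion reads m_1 m_3 = m_2 + q m_3, which forces
    \<open>q = 0\<close>.\<close>
  fix x :: 'a
  have "n * E 1 $ x $ x * (n * E 3 $ x $ x) = n * E 2 $ x $ x + q * (n * E 3 $ x $ x)"
    using arg_cong[OF exp, of "\<lambda>M. n * M $ x $ x"] by (simp add: algebra_simps)
  then have "q * (E 3 \<bullet> E 3) = 0"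
    using mult by (simp add: E_diag)
  then have "q = 0" using pos[of 3] by simp
  then show ?thesis using exp by simp
qed

text \<open>The common size of the fibres: the denominator is the rank of \<open>E 0 + E 3\<close>,
  which is the number of fibres.\<close>

definition v :: real where "v = n / (1 + E 3 \<bullet> E 3)"

definition G :: "real^'a^'a" where "G = adj_matrix (R 0 \<union> R 2)"

definition th :: "'a \<Rightarrow> 'a \<Rightarrow> real" where "th x y = n * E 1 $ x $ y"

lemma v_pos: "v > 0"
  unfolding v_def using n_pos inner_ge_zero[of "E 3"] by (intro divide_pos_pos) linarith+

lemma G_nth: "G $ x $ y = (if (x, y) \<in> R 0 \<union> R 2 then 1 else 0)"
  by (simp add: G_def adj_matrix_nth)

text \<open>The scalar left open by antipodality is found by comparing diagonal entries.\<close>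

lemma G_eq: "G = v *\<^sub>R (E 0 + E 3)"
proof -
  have "{i. i \<le> 3 \<and> R i \<subseteq> R 0 \<union> R 2} = {0, 2}"
  proof -
    have "i = 0 \<or> i = 2" if i: "i \<le> 3" "R i \<subseteq> R 0 \<union> R 2" for i
    proof -
      obtain x y where "(x, y) \<in> R i" using R_nonempty[OF i(1)] by auto
      then show ?thesis using i R_unique[of i 0 x y] R_unique[of i 2 x y] by auto
    qed
    then show ?thesis by auto
  qed
  moreover obtain c where
    "(\<Sum>i | i \<le> 3 \<and> R i \<subseteq> R 0 \<union> R 2. adj_matrix (R i)) = c *\<^sub>R (E 0 + E 3)"
    using antipodal by (auto simp: Q_antipodal_with_def)
  ultimately have c: "adj_matrix (R 0) + adj_matrix (R 2) = c *\<^sub>R (E 0 + E 3)" by simp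
  have "R 0 \<inter> R 2 = {}" using R_unique[of 0 2] by auto
  then have "G = adj_matrix (R 0) + adj_matrix (R 2)"
    by (auto simp: vec_eq_iff G_nth adj_matrix_nth)
  with c have G: "G = c *\<^sub>R (E 0 + E 3)" by simp
  fix x :: 'a
  have "1 = c * (1 / n + E 3 $ x $ x)"
    using arg_cong[OF G, of "\<lambda>M. M $ x $ x"] by (simp add: G_nth R_0 E_0_nth)
  also have "\<dots> = c * (1 + E 3 \<bullet> E 3) / n"
    using n_pos E_diag[of 3 x] by (simp add: field_simps)
  finally have "n = c * (1 + E 3 \<bullet> E 3)"
    using n_pos by (simp add: field_simps)
  moreover have "1 + E 3 \<bullet> E 3 > 0" by (simp add: add_pos_nonneg)
  ultimately have "c = v"
    unfolding v_def by simp
  with G show ?thesis by simp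
qed

lemma G_in_BM: "G \<in> BM"
  unfolding G_eq using E_in_BM subspace_bose_mesner by (simp add: subspace_scale subspace_add)

lemma equiv_R: "equiv UNIV (R 0 \<union> R 2)"
  using antipodal by (simp add: Q_antipodal_with_def)

lemma G_iff: "G $ x $ y = 1 \<longleftrightarrow> (x, y) \<in> R 0 \<union> R 2"
  by (simp add: G_nth)

sublocale linked_simplices "\<lambda>x y. G $ x $ y" th v n
proof
  have trans: "G $ x $ y = 1 \<Longrightarrow> G $ y $ z = 1 \<Longrightarrow> G $ x $ z = 1" for x y z
    using equiv_R unfolding G_iff equiv_def by (meson transD)
  have G_01: "G $ x $ y = 0 \<or> G $ x $ y = 1" for x y
    by (simp add: G_nth)
  have sym: "G $ x $ y = G $ y $ x" for x y
    by (rule bose_mesner_sym[OF G_in_BM])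
  \<comment> \<open>The rows of \<open>E 0 + E 3\<close> are orthogonal to those of
    \<open>E 1\<close>, which gives \<open>th_row\<close>; the case \<open>k = 0\<close> gives the
    fibre size.\<close>
  have E_row: "(\<Sum>u\<in>UNIV. G $ x $ u * E k $ y $ u)
      = v * ((if k = 0 then E 0 $ x $ y else 0) + (if k = 3 then E 3 $ x $ y else 0))"
    if "k \<le> 3" for k x y
  proof -
    have "(\<Sum>u\<in>UNIV. G $ x $ u * E k $ y $ u) = v * ((\<Sum>u\<in>UNIV. E 0 $ x $ u * E k $ y $ u)
        + (\<Sum>u\<in>UNIV. E 3 $ x $ u * E k $ y $ u))"
      by (simp add: G_eq sum.distrib sum_distrib_left algebra_simps)
    also have "\<dots> = v * ((if 0 = k then E 0 $ x $ y else 0) + (if 3 = k then E 3 $ x $ y else 0))"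
      by (simp only: E_row_orthogonal[OF le0 that] E_row_orthogonal[OF order_refl that])
    finally show ?thesis by auto
  qed
  fix x y z :: 'a
  show "n = real CARD('a)" by (rule n_def)
  show "v > 0" by (rule v_pos)
  show "G $ x $ y = 0 \<or> G $ x $ y = 1" by (rule G_01)
  show "G $ x $ x = 1" by (simp add: G_nth R_0)
  show "G $ x $ y = G $ y $ x" by (rule sym)
  show "G $ x $ y * G $ x $ z = G $ x $ y * G $ y $ z"
    using trans[of y x z] trans[of x y z] sym[of x y] G_01[of x y] G_01[of x z] G_01[of y z]
    by auto
  show "(\<Sum>u\<in>UNIV. G $ x $ u) = v"
    using E_row[of 0 x x] n_pos by (simp add: E_0_nth sum_divide_distrib[symmetric])
  show "th x y = th y x"
    unfolding th_def using bose_mesner_sym[OF E_in_BM[of 1]] by simp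
  show "(\<Sum>u\<in>UNIV. G $ x $ u * th y u) = 0"
    using E_row[of 1 x y] by (simp add: th_def sum_distrib_left[symmetric] mult.left_commute)
  show "(\<Sum>u\<in>UNIV. th x u * th y u) = n * th x y"
    using E_row_orthogonal[of 1 1 x y]
    by (simp add: th_def sum_distrib_left[symmetric] mult_ac)
  \<comment> \<open>Entrywise, \<open>E 0 + E 3\<close> times \<open>n *\<^sub>R E 1\<close> is
    \<open>E 1 + E 2\<close> by \<open>hadamard_E_1_E_3\<close>, and this is the identity minus
    \<open>E 0 + E 3\<close>.\<close>
  show "G $ x $ y * th x y = v * of_bool (x = y) - G $ x $ y"
  proof -
    have "G $ x $ y * th x y = v * (E 1 $ x $ y + n * (E 1 $ x $ y * E 3 $ x $ y))"
      using n_pos by (simp add: G_eq th_def E_0_nth algebra_simps)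
    also have "n * (E 1 $ x $ y * E 3 $ x $ y) = E 2 $ x $ y"
      using arg_cong[OF hadamard_E_1_E_3, of "\<lambda>M. M $ x $ y"] by simp
    also have "E 1 $ x $ y + E 2 $ x $ y = of_bool (x = y) - (E 0 $ x $ y + E 3 $ x $ y)"
      using arg_cong[OF sum_E, of "\<lambda>M. M $ x $ y"]
      unfolding sum_atMost_3 by (auto simp: mat_def split: if_splits)
    finally show ?thesis
      by (simp add: G_eq algebra_simps)
  qed
qed

section \<open>Triple products over a spanning set of the algebra\<close>

lemma BM_subset_span: "BM \<subseteq> span {\<chi> x y. 1, G, mat 1, n *\<^sub>R E 1}" (is "_ \<subseteq> span ?S")
proof -
  have base: "M \<in> ?S \<Longrightarrow> M \<in> span ?S" for M by (rule span_base)
  have E0: "E 0 \<in> span ?S"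
  proof -
    have "E 0 = (1 / n) *\<^sub>R (\<chi> x y. 1)" by (simp add: vec_eq_iff E_0_nth)
    then show ?thesis using span_scale[OF base[of "\<chi> x y. 1"]] by simp
  qed
  have E1: "E 1 \<in> span ?S"
    using span_scale[OF base[of "n *\<^sub>R E 1"], of "1 / n"] n_pos by simp
  have E3: "E 3 \<in> span ?S"
  proof -
    have "E 3 = (1 / v) *\<^sub>R G - E 0" using v_pos by (simp add: G_eq)
    then show ?thesis using span_diff[OF span_scale[OF base[of G]] E0] by simp
  qed
  have E2: "E 2 \<in> span ?S"
  proof -
    have "E 2 = mat 1 - E 0 - E 1 - E 3"
      unfolding sum_E[symmetric] sum_atMost_3 by simp
    then show ?thesis using span_diff[OF span_diff[OF span_diff[OF base[of "mat 1"] E0] E1] E3] by simp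
  qed
  have "E k \<in> span ?S" if "k \<le> 3" for k
  proof -
    have "k = 0 \<or> k = 1 \<or> k = 2 \<or> k = 3" using that by linarith
    then show ?thesis using E0 E1 E2 E3 by blast
  qed
  then have "E ` {..3} \<subseteq> span ?S" by (simp add: image_subset_iff)
  then show ?thesis unfolding BM_eq_span by (intro span_minimal subspace_span)
qed

lemma triple_product_cubic: "triple_product (n *\<^sub>R E 1) (n *\<^sub>R E 1) (n *\<^sub>R E 1) = cubic"
  by (simp add: fun_eq_iff triple_product_def cubic_def th_def)

text \<open>Both sides are multiples of the sum of the cubes of the entries of \<open>E 1\<close>;
  on the left this comes from the inner product formula for Krein numbers.\<close>

lemma a_star_eq: "n^2 * (E 1 \<bullet> E 1) * a_star 3 E 1 = (\<Sum>u\<in>UNIV. cubic u u u)"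
proof -
  have "(\<Sum>u\<in>UNIV. cubic u u u) = n^3 * ((E 1 * E 1) \<bullet> E 1)"
    by (simp add: cubic_def th_def inner_vec_def sum_distrib_left power3_eq_cube mult_ac)
  then show ?thesis
    using E_inner_pos[of 1] by (simp add: a_star_def krein_eq power2_eq_square power3_eq_cube)
qed

lemma triple_product_all_ones:
  assumes "B \<in> BM" "C \<in> BM"
  shows "triangle_invariant (triple_product (\<chi> x y. 1) B C)"
proof -
  have "triple_product (\<chi> x y. 1) B C x y z = (B ** C) $ y $ z" for x y z
    by (simp add: triple_product_def matrix_matrix_mult_def bose_mesner_sym[OF assms(2), of z])
  then have "triple_product (\<chi> x y. 1) B C = (\<lambda>x y z. (B ** C) $ y $ z)" by (simp add: fun_eq_iff)
  then show ?thesis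
    using triangle_invariant_rotate[OF triangle_invariant_matrix[OF matrix_mult_in_bose_mesner[OF assms]]]
    by simp
qed

lemma triple_product_mat_1:
  assumes "B \<in> BM" "C \<in> BM"
  shows "triangle_invariant (triple_product (mat 1) B C)"
proof -
  have "triple_product (mat 1) B C x y z = B $ y $ x * C $ z $ x" for x y z
    by (simp add: triple_product_def mat_def if_distrib[of "\<lambda>c. c * _"] cong: if_cong)
  then have "triple_product (mat 1) B C = (\<lambda>x y z. B $ x $ y * C $ z $ x)"
    by (simp add: fun_eq_iff bose_mesner_sym[OF assms(1)])
  then show ?thesis
    using triangle_invariant_combine[OF triangle_invariant_matrix[OF assms(1)]
        triangle_invariant_rotate[OF triangle_invariant_rotate[OF triangle_invariant_matrix[OF assms(2)]]],
        of "(*)"] by simp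
qed

text \<open>A point \<open>u\<close> equivalent to both \<open>x\<close> and \<open>y\<close> exists
  only if these are equivalent, and then one of the two conditions on \<open>u\<close> suffices.
  What remains is an entry of \<open>C ** G\<close>.\<close>

lemma triple_product_G_G:
  assumes "C \<in> BM"
  shows "triangle_invariant (triple_product G G C)"
proof -
  have "triple_product G G C x y z = G $ x $ y * (C ** G) $ z $ x" for x y z
  proof -
    have "G $ x $ u * G $ y $ u * C $ z $ u = G $ x $ y * (C $ z $ u * G $ u $ x)" for u
      using g_trans[of u x y] by (auto simp: g_sym[of x u] g_sym[of y u])
    then show ?thesis
      by (simp only: triple_product_def matrix_matrix_mult_def vec_lambda_beta sum_distrib_left)
  qed
  then have "triple_product G G C = (\<lambda>x y z. G $ x $ y * (C ** G) $ z $ x)" by (simp add: fun_eq_iff)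
  then show ?thesis
    using triangle_invariant_combine[OF triangle_invariant_matrix[OF G_in_BM]
        triangle_invariant_rotate[OF triangle_invariant_rotate[OF triangle_invariant_matrix[OF
          matrix_mult_in_bose_mesner[OF assms G_in_BM]]]], of "(*)"] by simp
qed

text \<open>By \<open>fibre_conv\<close> the sum over a fibre does not depend on the fibre, so
  \<open>x\<close> drops out.\<close>

lemma triple_product_G_th:
  "triangle_invariant (triple_product G (n *\<^sub>R E 1) (n *\<^sub>R E 1))"
proof -
  have in_BM: "(v * n) *\<^sub>R E 1 \<in> BM"
    using E_in_BM[of 1] subspace_bose_mesner by (intro subspace_scale) simp_all
  have "triple_product G (n *\<^sub>R E 1) (n *\<^sub>R E 1) x y z = ((v * n) *\<^sub>R E 1) $ y $ z" for x y z
    using fibre_conv[of x y z] bose_mesner_sym[OF E_in_BM[of 1], of z y]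
    by (simp add: triple_product_def th_sym[of _ z]) (simp add: th_def)
  then have "triple_product G (n *\<^sub>R E 1) (n *\<^sub>R E 1) = (\<lambda>x y z. ((v * n) *\<^sub>R E 1) $ y $ z)"
    by (simp add: fun_eq_iff)
  then show ?thesis
    using triangle_invariant_rotate[OF triangle_invariant_matrix[OF in_BM]] by simp
qed

lemma triply_regular_if:
  assumes "a_star 3 E 1 = 0"
  shows "triply_regular 3 R"
  unfolding triply_regular_iff
proof (intro ballI)
  let ?th = "n *\<^sub>R E 1"
  let ?S = "{\<chi> x y. 1, G, mat 1, ?th}"
  have S: "M \<in> BM" if "M \<in> ?S" for M
    using that bose_mesner_const[of 1] G_in_BM mat_1_in_bose_mesner
      subspace_scale[OF subspace_bose_mesner E_in_BM[of 1]] by auto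
  have "cubic x y z = 0" for x y z
    using a_star_eq assms by (intro cubic_eq_0) simp
  then have "cubic = (\<lambda>x y z. 0)" by (simp add: fun_eq_iff)
  then have th3: "triangle_invariant (triple_product ?th ?th ?th)"
    using triangle_invariant_const[of 0] by (simp only: triple_product_cubic)
  have special: "triangle_invariant (triple_product A B C)"
    if "A = (\<chi> x y. 1) \<or> A = mat 1" "B \<in> ?S" "C \<in> ?S" for A B C
    using that(1) triple_product_all_ones[OF S[OF that(2)] S[OF that(3)]]
      triple_product_mat_1[OF S[OF that(2)] S[OF that(3)]] by fast
  fix A B C assume "A \<in> BM" "B \<in> BM" "C \<in> BM"
  then have "A \<in> span ?S" "B \<in> span ?S" "C \<in> span ?S" using BM_subset_span by auto
  then show "triangle_invariant (triple_product A B C)"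
  proof (rule triple_product_span[rotated])
    fix A B C assume ABC: "A \<in> ?S" "B \<in> ?S" "C \<in> ?S"
    consider "A = (\<chi> x y. 1) \<or> A = mat 1" | "B = (\<chi> x y. 1) \<or> B = mat 1"
      | "C = (\<chi> x y. 1) \<or> C = mat 1" | "A \<in> {G, ?th}" "B \<in> {G, ?th}" "C \<in> {G, ?th}"
      using ABC by blast
    then show "triangle_invariant (triple_product A B C)"
    proof cases
      case 1
      then show ?thesis using special ABC by blast
    next
      case 2
      then show ?thesis using triple_product_rotate[OF triple_product_rotate[OF special]] ABC by blast
    next
      case 3
      then show ?thesis using triple_product_rotate[OF special] ABC by blast
    next
      case 4
      note GG = triple_product_G_G[OF S, of G] triple_product_G_G[OF S, of ?th]
      note rot = triple_product_rotate[OF triple_product_G_th] triple_product_rotate[OF GG(2)]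
      show ?thesis
        using 4 th3 GG triple_product_G_th rot rot[THEN triple_product_rotate] by auto
    qed
  qed
qed

lemma th_eq_imp_G_eq:
  assumes "th x y = th x' y'"
  shows "G $ x $ y = G $ x' $ y'"
proof -
  obtain p where "\<And>x y. n * E 3 $ x $ y = poly p (th x y)"
    using Q_polyD[of 3] unfolding th_def by auto
  then have "n * E 3 $ x $ y = n * E 3 $ x' $ y'" using assms by simp
  then show ?thesis using n_pos by (simp add: G_eq E_0_nth)
qed

lemma a_star_eq_0_if:
  assumes "triply_regular 3 R"
  shows "a_star 3 E 1 = 0"
proof -
  have "n *\<^sub>R E 1 \<in> BM" using subspace_scale[OF subspace_bose_mesner E_in_BM[of 1]] by simp
  then have "triangle_invariant cubic"
    using assms unfolding triply_regular_iff triple_product_cubic[symmetric] by simp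
  then obtain c where "\<forall>i\<le>3. \<forall>j\<le>3. \<forall>k\<le>3. \<forall>x y z.
     (x, y) \<in> R i \<longrightarrow> (y, z) \<in> R j \<longrightarrow> (z, x) \<in> R k \<longrightarrow> cubic x y z = c i j k"
    unfolding triangle_invariant_def by (rule exE)
  then have c: "cubic x y z = c i j k"
    if "i \<le> 3" "j \<le> 3" "k \<le> 3" "(x, y) \<in> R i" "(y, z) \<in> R j" "(z, x) \<in> R k" for i j k x y z
    using that by simp
  have R_2: "(x, y) \<in> R 2" if "G $ x $ y = 1" "x \<noteq> y" for x y
    using that by (simp add: G_iff R_0)
  have R_2_sym: "(y, x) \<in> R 2" if "(x, y) \<in> R 2" for x y
    using R_sym[of 2] that by simp
  obtain y0 p0 where yp: "(y0, p0) \<in> R 2" using R_nonempty[of 2] by auto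
  then have yp': "G $ y0 $ p0 = 1" "y0 \<noteq> p0"
    using R_unique[of 0 2 y0 p0] by (auto simp: G_iff R_0)
  obtain x y where "(x, y) \<in> R 1" using R_nonempty[of 1] by auto
  then have xy: "G $ x $ y = 0"
    using R_unique[of 0 1 x y] R_unique[of 2 1 x y] by (auto simp: G_nth)
  have "c 0 0 0 = 0 \<or> th x y = - 1 \<or> th x y = v - 1"
  proof (rule cubic_const_on_fibres[OF _ _ _ yp' xy])
    show "cubic x x x = c 0 0 0" for x
      by (rule c) (simp_all add: R_0)
    show "cubic x x p = c 0 2 2" if "G $ x $ p = 1" "x \<noteq> p" for x p
      by (rule c) (simp_all add: R_0 R_2 R_2_sym that)
    show "cubic x p q = c 2 2 2"
      if "G $ x $ p = 1" "G $ x $ q = 1" "x \<noteq> p" "x \<noteq> q" "p \<noteq> q" for x p q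
    proof -
      have "G $ p $ q = 1" using g_trans[of x p q] that by simp
      then show ?thesis by (intro c) (simp_all add: R_2 R_2_sym that)
    qed
  qed
  moreover have "th x y \<noteq> - 1"
    using th_eq_imp_G_eq[of x y y0 p0] th_in_fibre[OF yp'] yp' xy by auto
  moreover have "th x y \<noteq> v - 1"
    using th_eq_imp_G_eq[of x y x x] th_diag[of x] g_refl[of x] xy by auto
  ultimately have "c 0 0 0 = 0" by simp
  moreover have "cubic x x x = c 0 0 0" for x
    by (rule c) (simp_all add: R_0)
  ultimately have "(\<Sum>u\<in>UNIV. cubic u u u) = 0" by simp
  then show ?thesis
    using a_star_eq n_pos E_inner_pos[of 1] by simp
qed

end

theorem theorem2p2:
  fixes R :: "nat \<Rightarrow> ('a::finite) rel" and E :: "nat \<Rightarrow> real^'a^'a"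
  assumes "symmetric_association_scheme 3 R"
    and "primitive_idempotent_ordering 3 R E"
    and "Q_polynomial 3 E"
    and "Q_antipodal_with 3 R E (R 0 \<union> R 2)"
  shows "triply_regular 3 R \<longleftrightarrow> a_star 3 E 1 = 0"
proof -
  interpret antipodal_scheme R E
    using assms by unfold_locales
  show ?thesis using triply_regular_if a_star_eq_0_if by blast
qed

end
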